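(* There is an algorithm which takes as input oracles $\mathrm{MQ}(f)$ and $\mathrm{SAMP}(f)$ of some $f:\{0,1\}^n\to\{0,1\}$ with $f^{-1}(1)\ne\emptyset$, a positive integer $M$, a distance parameter $\varepsilon'\in(0,1)$ and a vector $\tilde d\in\{0,1,*\}^n$, makes $O(M/\varepsilon')$ calls to $\mathrm{MQ}(f)$ and $\mathrm{SAMP}(f)$, and rejects only when it has found two edges in $\mathsf{Edge}_i$ that violate unateness of $f$ along some coordinate $i$ with $\tilde d_i\in\{0,1\}$ (i.e. an edge in $\mathsf{Edge}_i^0(f)$ and an edge in $\mathsf{Edge}_i^1(f)$). Furthermore, when $\tilde d$ is consistent with $d^f$ and $$\sum_{i\in\mathsf{Fixed}(\tilde d)}\big|\mathsf{Edge}_i^{1-\tilde d_i}(f_{M,\tilde d})\big|\ge \varepsilon'|f^{-1}(1)|,$$ the algorithm rejects with probability at least $0.99$.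
   Context: $\mathrm{MQ}(f)$ returns $f(x)$ on query $x$; each call to $\mathrm{SAMP}(f)$ returns an independent uniformly random element of $f^{-1}(1)$. For $x\in\{0,1\}^n$ and $i\in[n]$, $x^{(i)}$ is $x$ with the $i$-th bit flipped. $\mathsf{Edge}_i$ is the set of pairs $\{x,x^{(i)}\}$. For $g:\{0,1\}^n\to\{0,1\}$, $\mathsf{Edge}_i^1(g)$ is the set of pairs $\{x,x^{(i)}\}$ with $x_i=0$, $g(x)=0$, $g(x^{(i)})=1$, and $\mathsf{Edge}_i^0(g)$ is the set of pairs $\{x,x^{(i)}\}$ with $x_i=0$, $g(x)=1$, $g(x^{(i)})=0$. The bias vector $d^f\in\{0,1,*\}^n$ has $d^f_i=1$ if $\Pr_{z\sim f^{-1}(1)}[z_i=1]>0.6$, $d^f_i=0$ if $\Pr_{z\sim f^{-1}(1)}[z_i=0]>0.6$, and $d^f_i=*$ otherwise ($z$ uniform over $f^{-1}(1)$). $\tilde d\in\{0,1,*\}^n$ is consistent with $d^f$ if $\tilde d_i=d^f_i$ for every $i$ with $\tilde d_i\ne *$. $\mathsf{Fixed}(\tilde d)=\{i:\tilde d_i\in\{0,1\}\}$. For $x\in\{0,1\}^n$, $\Delta(x,\tilde d)$ is the number of $i\in\mathsf{Fixed}(\tilde d)$ with $x_i\ne\tilde d_i$. The truncation $f_{M,\tilde d}(x)=f(x)$ if $\Delta(x,\tilde d)\le M$ and $0$ otherwise. *)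

theory Defs
  imports "HOL-Probability.Probability"
begin

text \<open>
  Bits are booleans (\<open>True\<close> is 1), points of the \<open>n\<close>-cube are boolean lists of length \<open>n\<close>, and
  coordinates are numbered from 0. A Boolean function on the cube is a function on all boolean
  lists of which only the values on \<^term>\<open>cube n\<close> are ever used. In vectors over \<open>{0, 1, *}\<close>, \<open>None\<close>
  stands for \<open>*\<close>.
\<close>

type_synonym point = "bool list"

definition cube :: "nat \<Rightarrow> point set" where
  "cube n = {x. length x = n}"

definition ones :: "nat \<Rightarrow> (point \<Rightarrow> bool) \<Rightarrow> point set" where
  "ones n f = {x \<in> cube n. f x}"

definition flip_bit :: "nat \<Rightarrow> point \<Rightarrow> point" where
  "flip_bit i x = x[i := \<not> x ! i]"

definition edges :: "nat \<Rightarrow> nat \<Rightarrow> point set set" where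
  "edges n i = {{x, flip_bit i x} | x. x \<in> cube n}"

text \<open>
  The edges in direction \<open>i\<close> along which \<open>g\<close> increases (\<open>b = True\<close>, the set \<open>Edge\<^sub>i\<^sup>1(g)\<close>) or
  decreases (\<open>b = False\<close>, the set \<open>Edge\<^sub>i\<^sup>0(g)\<close>).
\<close>

definition dir_edges :: "nat \<Rightarrow> nat \<Rightarrow> bool \<Rightarrow> (point \<Rightarrow> bool) \<Rightarrow> point set set" where
  "dir_edges n i b g =
     {{x, flip_bit i x} | x. x \<in> cube n \<and> \<not> x ! i \<and> g x = (\<not> b) \<and> g (flip_bit i x) = b}"

lemma dir_edges_subset_edges: "dir_edges n i b g \<subseteq> edges n i"
  unfolding dir_edges_def edges_def by blast

definition bias :: "nat \<Rightarrow> (point \<Rightarrow> bool) \<Rightarrow> bool option list" where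
  "bias n f = map (\<lambda>i.
     if measure_pmf.prob (pmf_of_set (ones n f)) {z. z ! i} > 0.6 then Some True
     else if measure_pmf.prob (pmf_of_set (ones n f)) {z. \<not> z ! i} > 0.6 then Some False
     else None) [0..<n]"

definition fixed :: "bool option list \<Rightarrow> nat set" where
  "fixed d = {i. i < length d \<and> d ! i \<noteq> None}"

definition consistent :: "bool option list \<Rightarrow> bool option list \<Rightarrow> bool" where
  "consistent d d' \<longleftrightarrow> length d = length d' \<and> (\<forall>i\<in>fixed d. d ! i = d' ! i)"

definition disagreement :: "point \<Rightarrow> bool option list \<Rightarrow> nat" where
  "disagreement x d = card {i \<in> fixed d. d ! i \<noteq> Some (x ! i)}"

definition truncation :: "(point \<Rightarrow> bool) \<Rightarrow> nat \<Rightarrow> bool option list \<Rightarrow> point \<Rightarrow> bool" where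
  "truncation f M d x \<longleftrightarrow> disagreement x d \<le> M \<and> f x"

text \<open>
  Randomized adaptive oracle algorithms as decision trees. \<open>Draw k\<close> draws internal randomness,
  uniform on \<open>{0, \<dots>, k}\<close>, and is not an oracle call; \<open>MQ x\<close> and \<open>SAMP\<close> are the two oracle calls.
\<close>

datatype verdict = Accept | Reject

datatype algorithm =
    Output verdict
  | Draw nat "nat \<Rightarrow> algorithm"
  | MQ point "bool \<Rightarrow> algorithm"
  | SAMP "point \<Rightarrow> algorithm"

text \<open>
  The joint distribution of the verdict and the transcript. The transcript has one entry per oracle
  call: the queried point for \<open>MQ\<close>, the returned point for \<open>SAMP\<close>. So its length is the number of
  calls, and its elements are the points at which the algorithm has learned the value of \<open>f\<close> (a
  sampled point is known to have value 1). Meaningful only if \<^term>\<open>ones n f\<close> is nonempty.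
\<close>

primrec run :: "nat \<Rightarrow> (point \<Rightarrow> bool) \<Rightarrow> algorithm \<Rightarrow> (verdict \<times> point list) pmf" where
  "run n f (Output v) = return_pmf (v, [])"
| "run n f (Draw k c) = bind_pmf (pmf_of_set {..k}) (\<lambda>j. run n f (c j))"
| "run n f (MQ x c) = map_pmf (\<lambda>(v, t). (v, x # t)) (run n f (c (f x)))"
| "run n f (SAMP c) =
     bind_pmf (pmf_of_set (ones n f)) (\<lambda>x. map_pmf (\<lambda>(v, t). (v, x # t)) (run n f (c x)))"

text \<open>
  The transcript contains all four endpoints of two edges that violate unateness of \<open>f\<close> along some
  coordinate fixed by \<open>d\<close>.
\<close>

definition found_violation ::
    "nat \<Rightarrow> (point \<Rightarrow> bool) \<Rightarrow> bool option list \<Rightarrow> point list \<Rightarrow> bool" where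
  "found_violation n f d t \<longleftrightarrow>
     (\<exists>i\<in>fixed d. \<exists>e0\<in>dir_edges n i False f. \<exists>e1\<in>dir_edges n i True f.
        e0 \<subseteq> set t \<and> e1 \<subseteq> set t)"

end

theory Submission imports Defs begin

text \<open>
  Every edge counted in the hypothesis has a unique endpoint \<open>x \<in> f\<^sup>-\<^sup>1(1)\<close>, and there \<open>x\<close> disagrees
  with \<open>d\<close> at \<open>i\<close>, \<open>\<Delta>(x, d) \<le> M\<close>, and \<open>f\<close> vanishes at the other endpoint, because flipping \<open>i\<close>
  lowers \<open>\<Delta>\<close>. So for a sample \<open>x\<close> and a uniformly random coordinate \<open>i\<close> among those where \<open>x\<close>
  disagrees with \<open>d\<close>, the edge at \<open>x\<close> in direction \<open>i\<close> decreases towards \<open>d\<close> with probability at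
  least \<open>\<epsilon> / M\<close>. Given such an \<open>i\<close>, a fresh sample \<open>z\<close> has \<open>z\<^sub>i = d\<^sub>i\<close> with probability above \<open>0.6\<close>,
  and flipping bit \<open>i\<close> injects those \<open>z\<close> whose flipped point is still in \<open>f\<^sup>-\<^sup>1(1)\<close> into a set of
  measure below \<open>0.4\<close>; so with probability at least \<open>0.2\<close> the edge at \<open>z\<close> is an opposite one.
  The algorithm repeats this trial \<open>O(M / \<epsilon>)\<close> times.
\<close>

section \<open>The algorithm as a chain of identical trials\<close>

definition disagreeing :: "bool option list \<Rightarrow> point \<Rightarrow> nat set" where
  "disagreeing d x = {i \<in> fixed d. d ! i \<noteq> Some (x ! i)}"

text \<open>The argument \<open>A\<close> is a continuation, run whenever the trial finds nothing,
  so trials chain by iteration. A sampled point is known to have value 1, hence only flipped points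
  are queried.\<close>

definition trial :: "bool option list \<Rightarrow> algorithm \<Rightarrow> algorithm" where
  "trial d A = SAMP (\<lambda>x. let cs = sorted_list_of_set (disagreeing d x) in
     if cs = [] then A else Draw (length cs - 1) (\<lambda>j. let i = cs ! j in
       MQ (flip_bit i x) (\<lambda>b. if b then A else SAMP (\<lambda>z.
         if d ! i = Some (z ! i)
         then MQ (flip_bit i z) (\<lambda>c. if c then A else Output Reject)
         else A))))"

definition tester :: "bool option list \<Rightarrow> nat \<Rightarrow> algorithm" where
  "tester d k = (trial d ^^ k) (Output Accept)"

section \<open>Bit flips and finiteness\<close>

lemma flip_bit_in_cube [simp]: "flip_bit i x \<in> cube n \<longleftrightarrow> x \<in> cube n"
  by (simp add: flip_bit_def cube_def)

lemma flip_bit_flip_bit [simp]: "flip_bit i (flip_bit i x) = x"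
  by (cases "i < length x") (simp_all add: flip_bit_def list_update_beyond)

lemma nth_flip_bit [simp]: "i < length x \<Longrightarrow> flip_bit i x ! i = (\<not> x ! i)"
  by (simp add: flip_bit_def)

lemma nth_flip_bit_neq: "j \<noteq> i \<Longrightarrow> flip_bit i x ! j = x ! j"
  by (simp add: flip_bit_def)

lemma finite_ones [simp]: "finite (ones n f)"
proof -
  have "finite (cube n)"
    using finite_lists_length_eq[of "UNIV :: bool set" n] by (simp add: cube_def)
  then show ?thesis by (rule rev_finite_subset) (auto simp: ones_def)
qed

lemma finite_fixed [simp]: "finite (fixed d)"
  by (simp add: fixed_def)

lemma finite_disagreeing [simp]: "finite (disagreeing d x)"
  by (simp add: disagreeing_def)

lemma disagreement_eq_card: "disagreement x d = card (disagreeing d x)"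
  by (simp add: disagreement_def disagreeing_def)

text \<open>The flip repairs coordinate \<open>i\<close> and leaves every other coordinate alone.
  The length hypothesis ensures that \<open>i\<close> is a genuine position of
  \<open>x\<close>.\<close>

lemma disagreement_flip_bit_le:
  assumes "i \<in> disagreeing d x" "length d = length x"
  shows "disagreement (flip_bit i x) d \<le> disagreement x d"
proof -
  have "disagreeing d (flip_bit i x) \<subseteq> disagreeing d x"
  proof
    fix j assume "j \<in> disagreeing d (flip_bit i x)"
    then show "j \<in> disagreeing d x"
      using assms by (cases "j = i") (auto simp: disagreeing_def nth_flip_bit_neq)
  qed
  then show ?thesis
    by (simp add: disagreement_eq_card card_mono)
qed

section \<open>Certificates of violated unateness\<close>

text \<open>\<open>dir_edges\<close> names an edge by its end with bit 0; if \<open>x ! i\<close>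
  holds, that end is the flipped point and the edge has to be rewritten from there.\<close>

lemma edge_in_dir_edges:
  assumes "x \<in> cube n" "i < n" "f x" "\<not> f (flip_bit i x)"
  shows "{x, flip_bit i x} \<in> dir_edges n i (x ! i) f"
proof (cases "x ! i")
  case True
  have "{x, flip_bit i x} = {flip_bit i x, flip_bit i (flip_bit i x)}" by auto
  moreover have "\<not> flip_bit i x ! i"
    using assms True by (simp add: cube_def)
  ultimately show ?thesis
    unfolding dir_edges_def mem_Collect_eq
    using assms True by (intro exI[of _ "flip_bit i x"]) simp
next
  case False
  then show ?thesis using assms unfolding dir_edges_def by blast
qed

lemma found_violation_mono:
  "found_violation n f d s \<Longrightarrow> set s \<subseteq> set t \<Longrightarrow> found_violation n f d t"
  unfolding found_violation_def by blast

text \<open>At \<open>i\<close> the point \<open>x\<close> disagrees with \<open>d\<close> and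
  \<open>z\<close> agrees, so their bits differ. As \<open>f\<close> drops from 1 to 0 when leaving
  either point, the two edges have opposite directions.\<close>

lemma found_violationI:
  assumes "length d = n" "i \<in> disagreeing d x" "d ! i = Some (z ! i)"
    and x: "x \<in> ones n f" "\<not> f (flip_bit i x)"
    and z: "z \<in> ones n f" "\<not> f (flip_bit i z)"
    and t: "{x, flip_bit i x, z, flip_bit i z} \<subseteq> set t"
  shows "found_violation n f d t"
proof -
  have i: "i < n" "i \<in> fixed d" "x ! i = (\<not> z ! i)"
    using assms(1-3) by (auto simp: disagreeing_def fixed_def)
  have ex: "{x, flip_bit i x} \<in> dir_edges n i (x ! i) f"
    using x i by (intro edge_in_dir_edges) (auto simp: ones_def)
  have ez: "{z, flip_bit i z} \<in> dir_edges n i (z ! i) f"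
    using z i by (intro edge_in_dir_edges) (auto simp: ones_def)
  show ?thesis
  proof (cases "z ! i")
    case True
    then show ?thesis using ex ez i t unfolding found_violation_def
      by (intro bexI[of _ i] bexI[of _ "{x, flip_bit i x}"] bexI[of _ "{z, flip_bit i z}"]) auto
  next
    case False
    then show ?thesis using ex ez i t unfolding found_violation_def
      by (intro bexI[of _ i] bexI[of _ "{z, flip_bit i z}"] bexI[of _ "{x, flip_bit i x}"]) auto
  qed
qed

section \<open>Transcripts: number of calls and one-sided error\<close>

text \<open>Shaped for induction along the chain: a trial either rejects with its certificate inside
  its own calls, or prepends at most four calls to a transcript of \<open>A\<close>.\<close>

lemma run_trial:
  assumes d: "length d = n" and ne: "ones n f \<noteq> {}"
    and vt: "(v, t) \<in> set_pmf (run n f (trial d A))"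
  obtains (reject) "v = Reject" "set t \<subseteq> cube n" "length t \<le> 4" "found_violation n f d t"
  | (continue) s u where "t = s @ u" "set s \<subseteq> cube n" "length s \<le> 4"
      "(v, u) \<in> set_pmf (run n f A)"
proof -
  obtain x t1 where x: "x \<in> ones n f" and t1: "t = x # t1"
    and r1: "(v, t1) \<in> set_pmf (run n f (let cs = sorted_list_of_set (disagreeing d x) in
       if cs = [] then A else Draw (length cs - 1) (\<lambda>j. let i = cs ! j in
       MQ (flip_bit i x) (\<lambda>b. if b then A else SAMP (\<lambda>z.
         if d ! i = Some (z ! i)
         then MQ (flip_bit i z) (\<lambda>c. if c then A else Output Reject)
         else A)))))"
    using vt ne by (auto simp: trial_def)
  have xc: "x \<in> cube n" using x by (simp add: ones_def)
  show thesis
  proof (cases "disagreeing d x = {}")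
    case True
    then show thesis using r1 t1 xc by (intro continue[of "[x]" t1]) auto
  next
    case False
    define cs where "cs = sorted_list_of_set (disagreeing d x)"
    have cs: "cs \<noteq> []" "set cs = disagreeing d x" using False by (auto simp: cs_def)
    obtain i t2 where i: "i \<in> disagreeing d x" and t2: "t1 = flip_bit i x # t2"
      and r2: "(v, t2) \<in> set_pmf (run n f (if f (flip_bit i x) then A else SAMP (\<lambda>z.
         if d ! i = Some (z ! i)
         then MQ (flip_bit i z) (\<lambda>c. if c then A else Output Reject)
         else A)))"
    proof -
      obtain j t2 where j: "j \<le> length cs - 1" and "t1 = flip_bit (cs ! j) x # t2"
        "(v, t2) \<in> set_pmf (run n f (if f (flip_bit (cs ! j) x) then A else SAMP (\<lambda>z.
         if d ! (cs ! j) = Some (z ! (cs ! j))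
         then MQ (flip_bit (cs ! j) z) (\<lambda>c. if c then A else Output Reject)
         else A)))"
        using r1 cs(1) unfolding cs_def[symmetric] Let_def
        by (auto simp del: run.simps(4) simp: set_pmf_of_set)
      moreover have "cs ! j \<in> disagreeing d x"
        using j cs by (metis One_nat_def Suc_pred le_imp_less_Suc length_greater_0_conv nth_mem)
      ultimately show thesis using that by blast
    qed
    show thesis
    proof (cases "f (flip_bit i x)")
      case True
      then show thesis using r2 t1 t2 xc by (intro continue[of "[x, flip_bit i x]" t2]) auto
    next
      case fx: False
      obtain z t3 where z: "z \<in> ones n f" and t3: "t2 = z # t3"
        and r3: "(v, t3) \<in> set_pmf (run n f (if d ! i = Some (z ! i)
         then MQ (flip_bit i z) (\<lambda>c. if c then A else Output Reject) else A))"
        using r2 fx ne by auto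
      have zc: "z \<in> cube n" using z by (simp add: ones_def)
      show thesis
      proof (cases "d ! i = Some (z ! i)")
        case False
        then show thesis
          using r3 t1 t2 t3 xc zc by (intro continue[of "[x, flip_bit i x, z]" t3]) auto
      next
        case dz: True
        show thesis
        proof (cases "f (flip_bit i z)")
          case True
          obtain t4 where "t3 = flip_bit i z # t4" "(v, t4) \<in> set_pmf (run n f A)"
            using r3 dz True by auto
          then show thesis using t1 t2 t3 xc zc
            by (intro continue[of "[x, flip_bit i x, z, flip_bit i z]" t4]) auto
        next
          case fz: False
          have t: "v = Reject" "t = [x, flip_bit i x, z, flip_bit i z]"
            using r3 dz fz t1 t2 t3 by auto
          have "found_violation n f d t"
            using d i dz x fx z fz by (rule found_violationI) (simp add: t)
          then show thesis using t xc zc by (intro reject) auto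
        qed
      qed
    qed
  qed
qed

lemma run_tester:
  assumes "length d = n" "ones n f \<noteq> {}" "(v, t) \<in> set_pmf (run n f (tester d k))"
  shows "set t \<subseteq> cube n \<and> length t \<le> 4 * k \<and> (v = Reject \<longrightarrow> found_violation n f d t)"
  using assms(3)
proof (induction k arbitrary: t)
  case 0
  then show ?case by (simp add: tester_def)
next
  case (Suc k)
  have "(v, t) \<in> set_pmf (run n f (trial d (tester d k)))"
    using Suc.prems by (simp add: tester_def)
  from assms(1,2) this show ?case
  proof (cases rule: run_trial)
    case reject
    then show ?thesis by simp
  next
    case (continue s u)
    with Suc.IH[of u] show ?thesis
      by (auto intro: found_violation_mono[of _ _ _ u])
  qed
qed

section \<open>Verdict probabilities\<close>

text \<open>Without the transcript, queries become transparent and \<open>Draw\<close> and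
  \<open>SAMP\<close> become plain averages, so probabilities can be computed by rewriting.\<close>

definition verdict_prob :: "nat \<Rightarrow> (point \<Rightarrow> bool) \<Rightarrow> algorithm \<Rightarrow> verdict \<Rightarrow> real" where
  "verdict_prob n f A v = pmf (map_pmf fst (run n f A)) v"

lemma verdict_prob_Output [simp]: "verdict_prob n f (Output w) v = of_bool (w = v)"
  by (simp add: verdict_prob_def)

lemma verdict_prob_MQ [simp]: "verdict_prob n f (MQ x c) v = verdict_prob n f (c (f x)) v"
  by (simp add: verdict_prob_def pmf.map_comp o_def case_prod_unfold)

lemma verdict_prob_Draw [simp]:
  "verdict_prob n f (Draw k c) v = (\<Sum>j\<le>k. verdict_prob n f (c j) v) / real (Suc k)"
  by (simp add: verdict_prob_def map_bind_pmf pmf_bind_pmf_of_set)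

lemma verdict_prob_SAMP [simp]:
  assumes "ones n f \<noteq> {}"
  shows "verdict_prob n f (SAMP c) v =
    (\<Sum>x\<in>ones n f. verdict_prob n f (c x) v) / real (card (ones n f))"
  using assms
  by (simp add: verdict_prob_def map_bind_pmf pmf_bind_pmf_of_set pmf.map_comp o_def
      case_prod_unfold)

lemma prob_Reject_eq_verdict_prob:
  "measure_pmf.prob (run n f A) {(v, t). v = Reject} = verdict_prob n f A Reject"
proof -
  have "{(v, t :: point list). v = Reject} = fst -` {Reject}" by auto
  then show ?thesis by (simp add: verdict_prob_def pmf_map)
qed

lemma verdict_prob_Accept: "verdict_prob n f A Accept = 1 - verdict_prob n f A Reject"
proof -
  have UNIV: "UNIV = {Accept, Reject}" using verdict.exhaust by blast
  have "(\<Sum>v\<in>{Accept, Reject}. verdict_prob n f A v) = 1"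
    unfolding verdict_prob_def
    by (rule sum_pmf_eq_1) (simp_all only: UNIV[symmetric] subset_UNIV, simp add: UNIV)
  then show ?thesis by simp
qed

text \<open>Acceptance factors because each accepting leaf of the single trial is replaced by the
  same \<open>A\<close>, which uses fresh randomness, while rejecting leaves contribute 0.\<close>

lemma verdict_prob_trial_Accept:
  assumes "ones n f \<noteq> {}"
  shows "verdict_prob n f (trial d A) Accept =
    verdict_prob n f (trial d (Output Accept)) Accept * verdict_prob n f A Accept"
  using assms
  by (simp add: trial_def Let_def sum_distrib_right sum_divide_distrib mult.assoc
      if_distrib[of "\<lambda>B. verdict_prob n f B Accept"] if_distrib[of "\<lambda>r. r * _"]
      if_distrib[of "\<lambda>r. r / _"] cong: if_cong)

lemma verdict_prob_tester_Accept:
  assumes "ones n f \<noteq> {}"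
  shows "verdict_prob n f (tester d k) Accept =
    verdict_prob n f (trial d (Output Accept)) Accept ^ k"
proof (induction k)
  case 0
  then show ?case by (simp add: tester_def)
next
  case (Suc k)
  then show ?case
    using verdict_prob_trial_Accept[OF assms, of d "tester d k"] by (simp add: tester_def)
qed

section \<open>Counting the useful edges\<close>

text \<open>For a sample \<open>x\<close>, these are the drawn coordinates with which the first half
  of a trial succeeds.\<close>

definition falling :: "(point \<Rightarrow> bool) \<Rightarrow> bool option list \<Rightarrow> point \<Rightarrow> nat set" where
  "falling f d x = {i \<in> disagreeing d x. \<not> f (flip_bit i x)}"

text \<open>For a coordinate found in the first half of a trial, these are the second samples that
  lead to rejection.\<close>

definition opposite :: "nat \<Rightarrow> (point \<Rightarrow> bool) \<Rightarrow> bool option list \<Rightarrow> nat \<Rightarrow> point set" where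
  "opposite n f d i = {z \<in> ones n f. d ! i = Some (z ! i) \<and> \<not> f (flip_bit i z)}"

lemma card_opposite_ge:
  assumes cons: "consistent d (bias n f)" and i: "i \<in> fixed d" and ne: "ones n f \<noteq> {}"
  shows "real (card (opposite n f d i)) \<ge> 0.2 * real (card (ones n f))"
proof -
  let ?N = "card (ones n f)"
  have N: "?N > 0" using ne by (simp add: card_gt_0_iff)
  obtain b where b: "d ! i = Some b" using i by (auto simp: fixed_def)
  have len: "length d = n" using cons by (simp add: consistent_def bias_def)
  have i_n: "i < n" using i len by (simp add: fixed_def)
  define S where "S = {z \<in> ones n f. z ! i = b}"
  define R where "R = {z \<in> ones n f. z ! i \<noteq> b}"
  have "bias n f ! i = Some b" using cons i b by (auto simp: consistent_def)
  then have "measure_pmf.prob (pmf_of_set (ones n f)) {z. z ! i = b} > 0.6"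
    using i_n by (cases b) (auto simp: bias_def split: if_splits)
  then have S: "real (card S) > 0.6 * ?N"
    using ne N by (simp add: measure_pmf_of_set S_def Int_def field_simps)
  have "card S + card R = ?N"
    by (subst card_Un_disjoint[symmetric]) (auto simp: S_def R_def intro!: arg_cong[of _ _ card])
  moreover have "card (S - opposite n f d i) \<le> card R"
  proof (rule card_inj_on_le)
    show "inj_on (flip_bit i) (S - opposite n f d i)"
      by (metis flip_bit_flip_bit inj_onI)
    show "flip_bit i ` (S - opposite n f d i) \<subseteq> R"
      using b i_n by (auto simp: S_def R_def opposite_def ones_def) (auto simp: cube_def)
  qed (simp add: R_def)
  moreover have "card (S - opposite n f d i) = card S - card (opposite n f d i)"
    and "card (opposite n f d i) \<le> card S"
    using b by (auto intro!: card_Diff_subset card_mono simp: opposite_def S_def)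
  \<comment> \<open>With \<open>N\<close> the number of ones, the count is at least
    \<open>card S - card R = 2 * card S - N\<close>, which exceeds
    \<open>(1.2 - 1) * N\<close>.\<close>
  ultimately show ?thesis using S by linarith
qed

text \<open>The end where the truncation is 1 disagrees with \<open>d\<close> at \<open>i\<close>.
  Flipping towards \<open>d\<close> stays within distance \<open>M\<close>, so the 0 at the other
  end comes from \<open>f\<close> and not from the cutoff.\<close>

lemma card_dir_edges_truncation_le:
  assumes "length d = n" "i \<in> fixed d"
  shows "card (dir_edges n i (\<not> the (d ! i)) (truncation f M d)) \<le>
    card {x \<in> ones n f. disagreement x d \<le> M \<and> i \<in> falling f d x}" (is "_ \<le> card ?S")
proof -
  have i: "i < n" using assms by (simp add: fixed_def)
  obtain b where b: "d ! i = Some b" using assms(2) by (auto simp: fixed_def)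
  have in_S: "y \<in> ?S" if y: "y \<in> cube n" "y ! i \<noteq> b" "truncation f M d y"
    "\<not> truncation f M d (flip_bit i y)" for y
  proof -
    have dis: "i \<in> disagreeing d y" using y(2) b assms(2) by (simp add: disagreeing_def)
    moreover have "disagreement (flip_bit i y) d \<le> disagreement y d"
      using dis by (rule disagreement_flip_bit_le) (use y(1) assms(1) in \<open>simp add: cube_def\<close>)
    ultimately show ?thesis
      using y by (auto simp: truncation_def ones_def falling_def)
  qed
  have "dir_edges n i (\<not> b) (truncation f M d) \<subseteq> (\<lambda>x. {x, flip_bit i x}) ` ?S"
  proof
    fix e assume "e \<in> dir_edges n i (\<not> b) (truncation f M d)"
    then obtain x where e: "e = {x, flip_bit i x}" and x: "x \<in> cube n" "\<not> x ! i"
      "truncation f M d x = b" "truncation f M d (flip_bit i x) = (\<not> b)"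
      by (auto simp: dir_edges_def)
    have "flip_bit i x ! i" using x i by (simp add: cube_def)
    show "e \<in> (\<lambda>x. {x, flip_bit i x}) ` ?S"
    \<comment> \<open>Since \<open>x\<close> is the end with bit 0, it carries the value 1 exactly
      when \<open>b\<close> is true; otherwise the flipped point does.\<close>
    proof (cases b)
      case True
      then have "x \<in> ?S" using x by (intro in_S) auto
      then show ?thesis unfolding e by blast
    next
      case False
      then have "flip_bit i x \<in> ?S" using x \<open>flip_bit i x ! i\<close> by (intro in_S) auto
      moreover have "e = {flip_bit i x, flip_bit i (flip_bit i x)}" unfolding e by auto
      ultimately show ?thesis by blast
    qed
  qed
  then have "card (dir_edges n i (\<not> b) (truncation f M d)) \<le> card ((\<lambda>x. {x, flip_bit i x}) ` ?S)"
    by (intro card_mono) auto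
  also have "\<dots> \<le> card ?S" by (intro card_image_le) simp
  finally show ?thesis by (simp add: b)
qed

text \<open>Double counting of the pairs of a point \<open>x\<close> and a coordinate in
  \<open>falling f d x\<close>.\<close>

lemma sum_card_dir_edges_truncation_le:
  assumes "length d = n"
  shows "(\<Sum>i\<in>fixed d. card (dir_edges n i (\<not> the (d ! i)) (truncation f M d))) \<le>
    (\<Sum>x | x \<in> ones n f \<and> disagreement x d \<le> M. card (falling f d x))"
proof -
  let ?T = "{x \<in> ones n f. disagreement x d \<le> M}"
  have "(\<Sum>i\<in>fixed d. card (dir_edges n i (\<not> the (d ! i)) (truncation f M d)))
      \<le> (\<Sum>i\<in>fixed d. card {x \<in> ?T. i \<in> falling f d x})"
    using card_dir_edges_truncation_le[OF assms] by (intro sum_mono) (simp add: conj_assoc)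
  also have "\<dots> = (\<Sum>i\<in>fixed d. \<Sum>x\<in>?T. of_bool (i \<in> falling f d x))"
    by (intro sum.cong refl) (simp add: Int_def)
  also have "\<dots> = (\<Sum>x\<in>?T. \<Sum>i\<in>fixed d. of_bool (i \<in> falling f d x))"
    by (rule sum.swap)
  also have "\<dots> = (\<Sum>x\<in>?T. card (falling f d x))"
    by (intro sum.cong refl) (auto simp: falling_def disagreeing_def intro!: arg_cong[of _ _ card])
  finally show ?thesis .
qed

section \<open>Rejection probability of one trial and its amplification\<close>

text \<open>An exact formula: average over the first sample, then over the drawn coordinate, then
  over the independent second sample.\<close>

lemma verdict_prob_trial_Reject:
  assumes "ones n f \<noteq> {}"
  shows "verdict_prob n f (trial d (Output Accept)) Reject =
    (\<Sum>x\<in>ones n f. (\<Sum>i\<in>falling f d x. card (opposite n f d i) / card (ones n f))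
       / disagreement x d) / card (ones n f)"
proof -
  have inner: "verdict_prob n f (let cs = sorted_list_of_set (disagreeing d x) in
     if cs = [] then Output Accept else Draw (length cs - 1) (\<lambda>j. let i = cs ! j in
       MQ (flip_bit i x) (\<lambda>b. if b then Output Accept else SAMP (\<lambda>z.
         if d ! i = Some (z ! i)
         then MQ (flip_bit i z) (\<lambda>c. if c then Output Accept else Output Reject)
         else Output Accept)))) Reject =
     (\<Sum>i\<in>falling f d x. card (opposite n f d i) / card (ones n f)) / disagreement x d" for x
  proof (cases "disagreeing d x = {}")
    case True
    \<comment> \<open>No coordinate can be drawn and the trial accepts; the right side is 0 / 0,
      which is 0.\<close>
    then show ?thesis by (simp add: falling_def)
  next
    case False
    define cs where "cs = sorted_list_of_set (disagreeing d x)"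
    define h where "h i = verdict_prob n f (MQ (flip_bit i x)
       (\<lambda>b. if b then Output Accept else SAMP (\<lambda>z.
         if d ! i = Some (z ! i)
         then MQ (flip_bit i z) (\<lambda>c. if c then Output Accept else Output Reject)
         else Output Accept))) Reject" for i
    have cs: "cs \<noteq> []" "set cs = disagreeing d x" "distinct cs" using False by (auto simp: cs_def)
    \<comment> \<open>\<open>Draw k\<close> averages over \<open>k + 1\<close> values; as
      \<open>cs\<close> is nonempty, the truncated subtraction is exact and the denominator is the
      disagreement.\<close>
    then have len: "Suc (length cs - 1) = card (disagreeing d x)"
      by (metis One_nat_def Suc_pred distinct_card length_greater_0_conv)
    have h: "h i = (if f (flip_bit i x) then 0 else card (opposite n f d i) / card (ones n f))" for i
    proof -
      have "(\<Sum>z\<in>ones n f. verdict_prob n f (if d ! i = Some (z ! i)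
         then MQ (flip_bit i z) (\<lambda>c. if c then Output Accept else Output Reject)
         else Output Accept) Reject) = (\<Sum>z\<in>ones n f. of_bool (z \<in> opposite n f d i))"
        by (intro sum.cong refl) (auto simp: opposite_def)
      also have "\<dots> = card (opposite n f d i)"
        by (auto simp: opposite_def intro!: arg_cong[of _ _ card])
      finally show ?thesis using assms by (simp add: h_def)
    qed
    have "(\<Sum>j\<le>length cs - 1. h (cs ! j)) = (\<Sum>i\<in>disagreeing d x. h i)"
    proof (rule sum.reindex_bij_betw)
      have "{..length cs - 1} = {..<length cs}"
        using cs(1) by (cases cs) (simp_all add: lessThan_Suc_atMost)
      then show "bij_betw ((!) cs) {..length cs - 1} (disagreeing d x)"
        using cs by (intro bij_betw_nth) auto
    qed
    also have "\<dots> = (\<Sum>i\<in>falling f d x. card (opposite n f d i) / card (ones n f))"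
      by (intro sum.mono_neutral_cong_right) (auto simp: falling_def h)
    finally have sum: "(\<Sum>j\<le>length cs - 1. h (cs ! j)) =
      (\<Sum>i\<in>falling f d x. card (opposite n f d i) / card (ones n f))" .
    show ?thesis
      using cs(1) unfolding cs_def[symmetric] Let_def
      by (simp only: if_False verdict_prob_Draw h_def[symmetric] sum len disagreement_eq_card)
  qed
  show ?thesis using assms inner by (simp add: trial_def)
qed

text \<open>Points with disagreement above \<open>M\<close> are discarded. For the others the chance
  of drawing a given coordinate is at least \<open>1 / M\<close>, and each falling coordinate then
  succeeds with probability at least 0.2.\<close>

lemma verdict_prob_trial_Reject_ge:
  assumes M: "M > 0" and d: "length d = n" and ne: "ones n f \<noteq> {}"
    and cons: "consistent d (bias n f)"
    and many: "real (\<Sum>i\<in>fixed d. card (dir_edges n i (\<not> the (d ! i)) (truncation f M d)))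
      \<ge> \<epsilon> * real (card (ones n f))"
  shows "verdict_prob n f (trial d (Output Accept)) Reject \<ge> 0.2 * \<epsilon> / M"
proof -
  let ?N = "real (card (ones n f))"
  let ?T = "{x \<in> ones n f. disagreement x d \<le> M}"
  let ?w = "\<lambda>x. (\<Sum>i\<in>falling f d x. card (opposite n f d i) / ?N)"
  have N: "?N > 0" using ne by (simp add: card_gt_0_iff)
  have "\<epsilon> * ?N \<le> (\<Sum>x\<in>?T. real (card (falling f d x)))"
    using many of_nat_mono[OF sum_card_dir_edges_truncation_le[OF d, of f M], where 'a=real] by simp
  then have "0.2 * \<epsilon> / M * ?N \<le> 0.2 / M * (\<Sum>x\<in>?T. real (card (falling f d x)))"
    using mult_left_mono[of _ _ "0.2 / real M"] by (simp add: mult.assoc)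
  also have "\<dots> = (\<Sum>x\<in>?T. 0.2 * real (card (falling f d x)) / M)"
    by (simp add: sum_distrib_left)
  also have "\<dots> \<le> (\<Sum>x\<in>?T. ?w x / disagreement x d)"
  proof (rule sum_mono)
    fix x assume x: "x \<in> ?T"
    have w: "0.2 * real (card (falling f d x)) \<le> ?w x"
    proof -
      have "(\<Sum>i\<in>falling f d x. 0.2) \<le> ?w x"
      proof (rule sum_mono)
        fix i assume "i \<in> falling f d x"
        then have "i \<in> fixed d" by (simp add: falling_def disagreeing_def)
        from card_opposite_ge[OF cons this ne] show "0.2 \<le> card (opposite n f d i) / ?N"
          using N by (simp add: field_simps)
      qed
      then show ?thesis by (simp add: mult.commute)
    qed
    show "0.2 * real (card (falling f d x)) / M \<le> ?w x / disagreement x d"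
    \<comment> \<open>Division by 0 gives 0 on the right, so this case needs that no coordinate
      falls.\<close>
    proof (cases "disagreement x d = 0")
      case True
      then have "falling f d x = {}" by (simp add: disagreement_eq_card falling_def)
      then show ?thesis by simp
    next
      case False
      then show ?thesis using x w by (intro frac_le) (auto intro: order_trans[OF _ w])
    qed
  qed
  also have "\<dots> \<le> (\<Sum>x\<in>ones n f. ?w x / disagreement x d)"
    by (intro sum_mono2) (auto intro!: divide_nonneg_nonneg sum_nonneg)
  finally show ?thesis
    unfolding verdict_prob_trial_Reject[OF ne] using N by (simp add: pos_le_divide_eq)
qed

lemma verdict_prob_tester_Reject_ge:
  assumes ne: "ones n f \<noteq> {}" and p: "verdict_prob n f (trial d (Output Accept)) Reject \<ge> p"
    and k: "p * real k \<ge> 7"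
  shows "verdict_prob n f (tester d k) Reject \<ge> 0.99"
proof -
  let ?a = "verdict_prob n f (trial d (Output Accept)) Accept"
  have "?a \<le> 1 - p" using p by (simp add: verdict_prob_Accept)
  also have "\<dots> \<le> exp (- p)" using exp_ge_add_one_self[of "- p"] by simp
  finally have "?a ^ k \<le> exp (- p) ^ k"
    by (intro power_mono) (simp_all add: verdict_prob_def)
  also have "\<dots> = exp (- (p * k))" by (simp add: exp_of_nat_mult[symmetric] mult.commute)
  also have "\<dots> \<le> exp (- 7)" using k by simp
  \<comment> \<open>The crude bound \<open>exp 1 \<ge> 2\<close> suffices, since 7 is the least
    exponent with \<open>2 ^ 7 \<ge> 100\<close>.\<close>
  also have "\<dots> \<le> 0.01"
  proof -
    have "(2 :: real) ^ 7 \<le> exp 1 ^ 7"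
      using exp_ge_add_one_self[of "1 :: real"] by (intro power_mono) auto
    then have "(128 :: real) \<le> exp 7" by (simp add: exp_of_nat_mult[symmetric])
    then show ?thesis by (simp add: exp_minus field_simps)
  qed
  finally have "verdict_prob n f (tester d k) Accept \<le> 0.01"
    by (simp add: verdict_prob_tester_Accept[OF ne])
  then show ?thesis by (simp add: verdict_prob_Accept)
qed

section \<open>Choice of the number of trials\<close>

theorem theorem4p1:
  "\<exists>(A :: nat \<Rightarrow> nat \<Rightarrow> real \<Rightarrow> bool option list \<Rightarrow> algorithm) (C :: real).
     \<forall>(n :: nat) (M :: nat) (\<epsilon> :: real) (d :: bool option list) (f :: point \<Rightarrow> bool).
       M > 0 \<longrightarrow> 0 < \<epsilon> \<longrightarrow> \<epsilon> < 1 \<longrightarrow> length d = n \<longrightarrow> ones n f \<noteq> {} \<longrightarrow>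
         (\<forall>(v, t) \<in> set_pmf (run n f (A n M \<epsilon> d)).
            set t \<subseteq> cube n \<and>
            real (length t) \<le> C * (real M / \<epsilon>) \<and>
            (v = Reject \<longrightarrow> found_violation n f d t)) \<and>
         (consistent d (bias n f) \<longrightarrow>
          real (\<Sum>i\<in>fixed d. card (dir_edges n i (\<not> the (d ! i)) (truncation f M d)))
            \<ge> \<epsilon> * real (card (ones n f)) \<longrightarrow>
          measure_pmf.prob (run n f (A n M \<epsilon> d)) {(v, t). v = Reject} \<ge> 0.99)"
proof (intro exI[of _ "\<lambda>n M \<epsilon> d. tester d (nat \<lceil>35 * (real M / \<epsilon>)\<rceil>)"] exI[of _ 144]
    allI impI conjI)
  fix n M :: nat and \<epsilon> :: real and d :: "bool option list" and f :: "point \<Rightarrow> bool"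
  assume M: "M > 0" and \<epsilon>: "0 < \<epsilon>" "\<epsilon> < 1" and d: "length d = n" and ne: "ones n f \<noteq> {}"
  \<comment> \<open>The factor 35 is 7 / 0.2: it makes the per-trial bound times \<open>k\<close> at
    least 7.\<close>
  define k where "k = nat \<lceil>35 * (real M / \<epsilon>)\<rceil>"
  \<comment> \<open>This absorbs the rounding in \<open>k\<close>: four calls per trial give
    \<open>4 * (35 * (M / \<epsilon>) + 1)\<close>, at most
    \<open>144 * (M / \<epsilon>)\<close>.\<close>
  have ratio: "real M / \<epsilon> \<ge> 1" using M \<epsilon> by (simp add: field_simps)
  have k: "35 * (real M / \<epsilon>) \<le> k" "k \<le> 35 * (real M / \<epsilon>) + 1"
    using ratio unfolding k_def by linarith+
  show "\<forall>(v, t) \<in> set_pmf (run n f (tester d k)).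
      set t \<subseteq> cube n \<and> real (length t) \<le> 144 * (real M / \<epsilon>) \<and>
      (v = Reject \<longrightarrow> found_violation n f d t)"
  proof (intro ballI, clarify)
    fix v t assume "(v, t) \<in> set_pmf (run n f (tester d k))"
    from run_tester[OF d ne this] k ratio
    show "set t \<subseteq> cube n \<and> real (length t) \<le> 144 * (real M / \<epsilon>) \<and>
        (v = Reject \<longrightarrow> found_violation n f d t)"
      by linarith
  qed
  assume "consistent d (bias n f)"
    and "real (\<Sum>i\<in>fixed d. card (dir_edges n i (\<not> the (d ! i)) (truncation f M d)))
      \<ge> \<epsilon> * real (card (ones n f))"
  note p = verdict_prob_trial_Reject_ge[OF M d ne this]
  have "7 = 0.2 * \<epsilon> / M * (35 * (real M / \<epsilon>))" using M \<epsilon> by simp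
  also have "\<dots> \<le> 0.2 * \<epsilon> / M * k" using k \<epsilon> by (intro mult_left_mono) auto
  finally show "measure_pmf.prob (run n f (tester d k)) {(v, t). v = Reject} \<ge> 0.99"
    unfolding prob_Reject_eq_verdict_prob
    using ne p by (intro verdict_prob_tester_Reject_ge) auto
qed

end
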